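(* Let $n,r\ge 1$ be integers and let $A_1,\dots,A_n,B_1,\dots,B_n,C$ be positive stable matrices in $\mathbb{C}^{r\times r}$ such that $\alpha(A_i)+\alpha(B_i)<2$ for $i=1,\dots,n$ and $\beta(C)>1$. Then the series $$F_{\mathcal{B}}[A_1,\dots,A_n,B_1,\dots,B_n;C;x_1,\dots,x_n]=\sum_{m_1,\dots,m_n=0}^{\infty}(A_1)_{m_1}\cdots(A_n)_{m_n}(B_1)_{m_1}\cdots(B_n)_{m_n}(C)_{m_1+\cdots+m_n}^{-1}\,\frac{x_1^{m_1}\cdots x_n^{m_n}}{m_1!\cdots m_n!}$$ converges absolutely for all $x_1,\dots,x_n\in\mathbb{C}$ with $|x_1|<1,\dots,|x_n|<1$.
   Context: For $M\in\mathbb{C}^{r\times r}$ with spectrum $\sigma(M)$, $\alpha(M)=\max\{\Re(z):z\in\sigma(M)\}$ and $\beta(M)=\min\{\Re(z):z\in\sigma(M)\}$; $M$ is positive stable if $\beta(M)>0$. The Pochhammer symbol is $(M)_0=I$ and $(M)_k=M(M+I)\cdots(M+(k-1)I)$ for $k\ge1$; $(M)_k^{-1}$ denotes the inverse matrix of $(M)_k$. Matrix products are taken in the written order (no commutativity is assumed). Absolute convergence means that the series of norms of the terms converges. *)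

theory Defs
  imports "HOL-Analysis.Analysis"
begin

type_synonym 'r cmatrix = "complex ^ 'r ^ 'r"

(* The ring operations of the vec type act componentwise, so the matrix product and
   unit are written ** and mat 1 throughout; in particular the library's pochhammer and
   the generic scalar and power operations are not the matrix ones. *)

definition spectrum :: "'r::finite cmatrix \<Rightarrow> complex set" where
  "spectrum M = {z. \<exists>v. v \<noteq> 0 \<and> M *v v = z *s v}"

(* The spectrum is finite and nonempty (every 'r has at least one element), so Max and Min
   are taken over finite nonempty sets. *)

definition spec_max :: "'r::finite cmatrix \<Rightarrow> real" where
  "spec_max M = Max (Re ` spectrum M)"

definition spec_min :: "'r::finite cmatrix \<Rightarrow> real" where
  "spec_min M = Min (Re ` spectrum M)"

definition positive_stable :: "'r::finite cmatrix \<Rightarrow> bool" where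
  "positive_stable M \<longleftrightarrow> spec_min M > 0"

primrec mat_pochhammer :: "'r::finite cmatrix \<Rightarrow> nat \<Rightarrow> 'r cmatrix" where
  "mat_pochhammer M 0 = mat 1"
| "mat_pochhammer M (Suc k) = mat_pochhammer M k ** (M + mat (of_nat k))"

definition mat_scale :: "complex \<Rightarrow> 'r::finite cmatrix \<Rightarrow> 'r cmatrix" where
  "mat_scale c M = (\<chi> i j. c * M $ i $ j)"

(* mat_prod f n = f 1 ** f 2 ** ... ** f n *)
primrec mat_prod :: "(nat \<Rightarrow> 'r::finite cmatrix) \<Rightarrow> nat \<Rightarrow> 'r cmatrix" where
  "mat_prod f 0 = mat 1"
| "mat_prod f (Suc k) = mat_prod f k ** f (Suc k)"

definition multi_indices :: "nat \<Rightarrow> (nat \<Rightarrow> nat) set" where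
  "multi_indices n = {1..n} \<rightarrow>\<^sub>E UNIV"

(* matrix_inv is arbitrary on singular matrices; if C is positive stable, 0, -1, -2, ... are
   not eigenvalues of C, so every mat_pochhammer C k is invertible. *)
definition F_B_term ::
  "nat \<Rightarrow> (nat \<Rightarrow> 'r::finite cmatrix) \<Rightarrow> (nat \<Rightarrow> 'r cmatrix) \<Rightarrow> 'r cmatrix \<Rightarrow>
   (nat \<Rightarrow> complex) \<Rightarrow> (nat \<Rightarrow> nat) \<Rightarrow> 'r cmatrix" where
  "F_B_term n A B C x m =
     mat_scale (\<Prod>i=1..n. x i ^ m i / fact (m i))
       (mat_prod (\<lambda>i. mat_pochhammer (A i) (m i)) n **
        mat_prod (\<lambda>i. mat_pochhammer (B i) (m i)) n **
        matrix_inv (mat_pochhammer C (\<Sum>i=1..n. m i)))"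

(* The norm on complex ^ 'r ^ 'r is the Frobenius norm; as all norms on a
   finite-dimensional space are equivalent, the choice does not affect convergence. *)
definition F_B_converges_absolutely ::
  "nat \<Rightarrow> (nat \<Rightarrow> 'r::finite cmatrix) \<Rightarrow> (nat \<Rightarrow> 'r cmatrix) \<Rightarrow> 'r cmatrix \<Rightarrow>
   (nat \<Rightarrow> complex) \<Rightarrow> bool" where
  "F_B_converges_absolutely n A B C x \<longleftrightarrow>
     (\<lambda>m. norm (F_B_term n A B C x m)) summable_on multi_indices n"

end

theory Submission
  imports Defs
begin

text \<open>
  Write \<open>A\<^sub>i\<close>, \<open>B\<^sub>i\<close>, \<open>C\<close> for the parameter matrices and \<open>N\<close> for the sum of the indices
  \<open>m\<^sub>1, \<dots>, m\<^sub>n\<close>. Inside the polydisc the powers \<open>\<bar>x\<^sub>i\<bar>\<^sup>m\<close> decay exponentially, so every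
  estimate may be wasteful by a factor that is polynomial in the summation indices. This leaves
  only the factorials to be matched. With respect to the operator norm, \<open>A + m I\<close> has norm at
  most \<open>m + a\<close> once \<open>a\<close> exceeds the norm of \<open>A\<close>, so the Pochhammer product of \<open>A\<close> has norm at
  most \<open>m! (m + 1)\<^sup>a\<close> (\<open>mat_pochhammer_upper_bound\<close>). Conversely \<open>C + m I\<close> expands every
  vector by at least \<open>m - c\<close> when \<open>m\<close> exceeds a bound \<open>c\<close> of the norm of \<open>C\<close>, so the inverse
  of the Pochhammer product has norm at most \<open>(m + 1)\<^sup>b / m!\<close>
  (\<open>matrix_inv_mat_pochhammer_bound\<close>), provided that the finitely many factors with small \<open>m\<close>
  are invertible. That is what positive stability of \<open>C\<close> gives: no eigenvalue is one of
  \<open>0, -1, -2, \<dots>\<close>.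

  Since \<open>m\<^sub>1! \<cdots> m\<^sub>n! \<le> N!\<close> and \<open>N + 1 \<le> (m\<^sub>1 + 1) \<cdots> (m\<^sub>n + 1)\<close>, the factorials from the \<open>A\<^sub>i\<close>
  cancel against the denominators \<open>m\<^sub>i!\<close>, those from the \<open>B\<^sub>i\<close> against \<open>N!\<close>, and the term is
  dominated by a constant times the product of \<open>(m\<^sub>i + 1)\<^sup>k \<bar>x\<^sub>i\<bar>\<^sup>m\<close> with \<open>m = m\<^sub>i\<close> and an
  exponent \<open>k\<close> depending on \<open>i\<close>. That majorant is a product of convergent series in one variable.
\<close>

section \<open>Operator bounds for complex matrices\<close>

text \<open>
  The Frobenius norm of \<open>m I\<close> is \<open>m\<close> times the square root of the dimension, which would spoil
  the growth rate of a product of \<open>m\<close> factors. The bounds therefore refer to the action on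
  vectors.
\<close>

definition op_bound :: "'r::finite cmatrix \<Rightarrow> real \<Rightarrow> bool" where
  "op_bound M c \<longleftrightarrow> (\<forall>v. norm (M *v v) \<le> c * norm v)"

lemma norm_vector_scalar_mult: "norm (z *s (v :: complex ^ 'r)) = cmod z * norm v"
  by (simp add: norm_vec_def norm_mult L2_set_right_distrib)

lemma mat_mult_vector: "mat z *v v = z *s (v :: complex ^ 'r::finite)"
proof -
  have "(\<Sum>j\<in>UNIV. (if i = j then z else 0) * v $ j) = (\<Sum>j\<in>UNIV. if j = i then z * v $ j else 0)"
    for i by (rule sum.cong) auto
  then show ?thesis
    by (simp add: vec_eq_iff matrix_vector_mult_def mat_def)
qed

lemma op_bound_mono: "op_bound M c \<Longrightarrow> c \<le> d \<Longrightarrow> op_bound M d"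
  unfolding op_bound_def by (meson mult_right_mono norm_ge_zero order_trans)

lemma op_bound_exists: "\<exists>c::nat. op_bound M (real c)"
proof -
  obtain k where "\<forall>v. norm (M *v v) \<le> norm v * k"
    using bounded_linear.bounded[OF matrix_vector_mul_bounded_linear[of M]] by blast
  then have "op_bound M k"
    by (simp add: op_bound_def mult.commute)
  then show ?thesis
    using op_bound_mono real_arch_simple by blast
qed

lemma op_bound_mult:
  assumes "op_bound M c" "op_bound N d" "c \<ge> 0"
  shows "op_bound (M ** N) (c * d)"
  unfolding op_bound_def
proof
  fix v
  have "norm (M *v (N *v v)) \<le> c * norm (N *v v)"
    using assms(1) by (simp add: op_bound_def)
  also have "\<dots> \<le> c * (d * norm v)"
    using assms by (intro mult_left_mono) (auto simp: op_bound_def)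
  finally show "norm (M ** N *v v) \<le> c * d * norm v"
    by (simp add: matrix_vector_mul_assoc mult.assoc)
qed

lemma op_bound_mat_prod:
  assumes "\<And>i. op_bound (f i) (g i)" "\<And>i. g i \<ge> 0"
  shows "op_bound (mat_prod f n) (\<Prod>i=1..n. g i)"
proof (induction n)
  case 0
  show ?case by (simp add: op_bound_def)
next
  case (Suc n)
  then show ?case
    using op_bound_mult[OF Suc assms(1)] assms(2) by (simp add: prod_nonneg)
qed

text \<open>
  Every entry of a matrix is a coordinate of the image of a basis vector; this transfers an
  operator bound to the Frobenius norm, at the price of the number of entries.
\<close>

lemma norm_le_of_op_bound:
  fixes M :: "'r::finite cmatrix"
  assumes "op_bound M c"
  shows "norm M \<le> (real CARD('r))\<^sup>2 * c"
proof -
  have entry: "cmod (M $ i $ j) \<le> c" for i j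
  proof -
    have "M $ i $ j = (M *v axis j 1) $ i"
      by (simp add: matrix_vector_mult_def axis_def if_distrib cong: if_cong)
    then have "cmod (M $ i $ j) \<le> norm (M *v axis j 1)"
      by (simp add: Finite_Cartesian_Product.norm_nth_le)
    also have "\<dots> \<le> c * norm (axis j (1::complex) :: complex ^ 'r)"
      using assms unfolding op_bound_def by (rule spec)
    also have "norm (axis j (1::complex) :: complex ^ 'r) = 1"
      by (simp add: norm_eq_sqrt_inner inner_axis_axis)
    finally show ?thesis by simp
  qed
  have "norm M \<le> (\<Sum>i\<in>UNIV. norm (M $ i))"
    unfolding norm_vec_def[of M] by (rule L2_set_le_sum) simp
  also have "\<dots> \<le> (\<Sum>i\<in>(UNIV::'r set). \<Sum>j\<in>(UNIV::'r set). cmod (M $ i $ j))"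
    unfolding norm_vec_def[of "M $ i" for i] by (intro sum_mono L2_set_le_sum) simp
  also have "\<dots> \<le> (\<Sum>i\<in>(UNIV::'r set). \<Sum>j\<in>(UNIV::'r set). c)"
    by (intro sum_mono entry)
  finally show ?thesis by (simp add: power2_eq_square)
qed

lemma norm_mat_scale: "norm (mat_scale z M) = cmod z * norm M"
  by (simp add: norm_vec_def mat_scale_def norm_mult L2_set_right_distrib)

lemma op_bound_matrix_inv:
  fixes P :: "'r::finite cmatrix"
  assumes "\<And>v. norm v \<le> g * norm (P *v v)"
  shows "op_bound (matrix_inv P) g"
  unfolding op_bound_def
proof
  fix w
  have "\<forall>v. P *v v = 0 \<longrightarrow> v = 0"
    using assms by (metis mult_zero_right norm_le_zero_iff norm_zero)
  then have "invertible P"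
    by (simp add: invertible_left_inverse matrix_left_invertible_ker)
  then have "P ** matrix_inv P = mat 1"
    unfolding matrix_inv_def invertible_def by (rule someI2_ex) simp
  then have "P *v (matrix_inv P *v w) = w"
    by (simp add: matrix_vector_mul_assoc)
  then show "norm (matrix_inv P *v w) \<le> g * norm w"
    using assms[of "matrix_inv P *v w"] by simp
qed

section \<open>Positive stable matrices have no eigenvalue in the closed left half-plane\<close>

text \<open>
  The minimum that defines \<open>spec_min\<close> speaks about all eigenvalues only because the
  spectrum is finite, being contained in the zeros of the characteristic polynomial. That this
  polynomial is nonzero is seen from its value at a point larger than the operator norm.
\<close>

lemma finite_spectrum:
  fixes M :: "'r::finite cmatrix"
  shows "finite (spectrum M)"
proof -
  define p :: "complex poly" where
    "p = (\<Sum>\<pi> | \<pi> permutes (UNIV::'r set). of_int (sign \<pi>) *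
            (\<Prod>i\<in>UNIV. [:M $ i $ \<pi> i, - (if i = \<pi> i then 1 else 0):]))"
  have entry: "poly [:M $ i $ j, - (if i = j then 1 else 0):] z = (M - mat z) $ i $ j" for i j z
    by (simp add: mat_def)
  have p: "poly p z = det (M - mat z)" for z
    unfolding p_def det_def poly_sum poly_mult poly_prod poly_of_int entry ..
  have ev: "z \<in> spectrum M \<longleftrightarrow> poly p z = 0" for z
  proof -
    have "z \<in> spectrum M \<longleftrightarrow> \<not> (\<forall>v. (M - mat z) *v v = 0 \<longrightarrow> v = 0)"
      by (auto simp: spectrum_def matrix_vector_mult_diff_rdistrib mat_mult_vector)
    also have "\<dots> \<longleftrightarrow> \<not> invertible (M - mat z)"
      by (simp add: invertible_left_inverse matrix_left_invertible_ker)
    finally show ?thesis by (simp add: p invertible_det_nz)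
  qed
  obtain c :: nat where c: "op_bound M (real c)"
    using op_bound_exists by blast
  have "of_nat (Suc c) \<notin> spectrum M"
  proof
    assume "of_nat (Suc c) \<in> spectrum M"
    then obtain v where v: "v \<noteq> 0" "M *v v = of_nat (Suc c) *s v"
      by (auto simp: spectrum_def)
    have "real (Suc c) * norm v \<le> real c * norm v"
      using c[unfolded op_bound_def, rule_format, of v]
      unfolding v(2) norm_vector_scalar_mult norm_of_nat .
    then show False using v(1) by simp
  qed
  then have "p \<noteq> 0" unfolding ev by (metis poly_0)
  then have "finite {z. poly p z = 0}" by (rule poly_roots_finite)
  also have "{z. poly p z = 0} = spectrum M" unfolding set_eq_iff ev by blast
  finally show ?thesis .
qed

lemma positive_stable_spectrum:
  assumes "positive_stable M" "z \<in> spectrum M"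
  shows "Re z > 0"
proof -
  have "spec_min M \<le> Re z"
    unfolding spec_min_def using assms(2) finite_spectrum by (intro Min_le) auto
  then show ?thesis using assms(1) by (simp add: positive_stable_def)
qed

text \<open>
  A vector killed by \<open>C + k I\<close> would be an eigenvector for \<open>-k\<close>, so \<open>C + k I\<close> is invertible; the
  expansion constant is a bound of its inverse.
\<close>

lemma positive_stable_shift_expands:
  fixes C :: "'r::finite cmatrix"
  assumes "positive_stable C"
  shows "\<exists>d::nat. \<forall>v. norm v \<le> real d * norm ((C + mat (of_nat k)) *v v)"
proof -
  have "v = 0" if "(C + mat (of_nat k)) *v v = 0" for v
  proof (rule ccontr)
    assume "v \<noteq> 0"
    have "C *v v + of_nat k *s v = 0"
      using that by (simp add: matrix_vector_mult_add_rdistrib mat_mult_vector)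
    then have "C *v v = (- of_nat k) *s v"
      by (simp add: eq_neg_iff_add_eq_0 vector_smult_lneg)
    with \<open>v \<noteq> 0\<close> have "- of_nat k \<in> spectrum C"
      by (auto simp: spectrum_def)
    from positive_stable_spectrum[OF assms this] show False by simp
  qed
  then obtain D where D: "D ** (C + mat (of_nat k)) = mat 1"
    using matrix_left_invertible_ker by blast
  obtain d :: nat where d: "op_bound D (real d)"
    using op_bound_exists by blast
  have "norm v \<le> real d * norm ((C + mat (of_nat k)) *v v)" for v
    using d D unfolding op_bound_def by (metis matrix_vector_mul_assoc matrix_vector_mul_lid)
  then show ?thesis by blast
qed

section \<open>Growth of the Pochhammer products\<close>

text \<open>
  Bernoulli's inequality in the form \<open>1 + a / (m + 1) \<le> ((m + 2) / (m + 1))\<^sup>a\<close>. The right-hand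
  sides telescope, so replacing the factors \<open>m + 1\<close> of a factorial by \<open>m + 1 + a\<close> enlarges the
  product by a polynomial amount only.
\<close>

lemma shifted_factor_le_telescope:
  "(real m + 1 + real a) * (real m + 1) ^ a \<le> (real m + 1) * (real m + 2) ^ a"
proof -
  have "1 + real a * (1 / (real m + 1)) \<le> (1 + 1 / (real m + 1)) ^ a"
    by (rule Bernoulli_inequality) (simp add: divide_simps)
  also have "1 + 1 / (real m + 1) = (real m + 2) / (real m + 1)"
    by (simp add: divide_simps)
  also have "1 + real a * (1 / (real m + 1)) = (real m + 1 + real a) / (real m + 1)"
    by (simp add: divide_simps)
  finally have "(real m + 1 + real a) / (real m + 1) \<le> (real m + 2) ^ a / (real m + 1) ^ a"
    by (simp only: power_divide)
  then show ?thesis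
    by (simp add: divide_le_eq le_divide_eq mult.commute mult.left_commute)
qed

lemma mat_pochhammer_upper_bound:
  fixes M :: "'r::finite cmatrix"
  shows "\<exists>a. \<forall>m. op_bound (mat_pochhammer M m) (fact m * (real m + 1) ^ a)"
proof -
  obtain a :: nat where a: "op_bound M (real a)"
    using op_bound_exists by blast
  have factor: "op_bound (M + mat (of_nat m)) (real m + 1 + real a)" for m
    unfolding op_bound_def
  proof
    fix v
    have "norm ((M + mat (of_nat m)) *v v) \<le> norm (M *v v) + norm ((of_nat m :: complex) *s v)"
      by (simp add: matrix_vector_mult_add_rdistrib mat_mult_vector norm_triangle_ineq)
    also have "\<dots> \<le> real a * norm v + real m * norm v"
      using a by (simp add: op_bound_def norm_vector_scalar_mult)
    also have "\<dots> \<le> (real m + 1 + real a) * norm v"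
      by (simp add: algebra_simps)
    finally show "norm ((M + mat (of_nat m)) *v v) \<le> (real m + 1 + real a) * norm v" .
  qed
  have "op_bound (mat_pochhammer M m) (fact m * (real m + 1) ^ a)" for m
  proof (induction m)
    case 0
    show ?case by (simp add: op_bound_def)
  next
    case (Suc m)
    have "fact m * (real m + 1) ^ a * (real m + 1 + real a)
        \<le> fact m * ((real m + 1) * (real m + 2) ^ a)"
      using mult_left_mono[OF shifted_factor_le_telescope[of m a], of "fact m"]
      by (simp add: mult_ac)
    also have "\<dots> = fact (Suc m) * (real (Suc m) + 1) ^ a"
      by (simp add: algebra_simps)
    finally have "fact m * (real m + 1) ^ a * (real m + 1 + real a)
        \<le> fact (Suc m) * (real (Suc m) + 1) ^ a" .
    moreover have "op_bound (mat_pochhammer M (Suc m))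
        (fact m * (real m + 1) ^ a * (real m + 1 + real a))"
      using op_bound_mult[OF Suc factor[of m]] by simp
    ultimately show ?case by (rule op_bound_mono[rotated])
  qed
  then show ?thesis by blast
qed

text \<open>
  For large \<open>k\<close> the factor \<open>C + k I\<close> expands by \<open>k - c\<close>, which is at least
  \<open>(k + 1)\<^sup>2 / (k + 1 + b)\<close> as soon as \<open>b \<ge> c + 2\<close>; each of the remaining \<open>k\<close> is met by some
  \<open>b\<close>, and as there are finitely many of them, the sum of these \<open>b\<close> and \<open>c + 2\<close> serves all at
  once. The shape \<open>(k + 1 + b) / (k + 1)\<^sup>2\<close> of the inverse bound is the one to which
  \<open>shifted_factor_le_telescope\<close> applies.
\<close>

lemma positive_stable_shift_expands_uniformly:
  fixes C :: "'r::finite cmatrix"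
  assumes "positive_stable C"
  shows "\<exists>b::nat. \<forall>k v. (real k + 1)\<^sup>2 * norm v
           \<le> (real k + 1 + real b) * norm ((C + mat (of_nat k)) *v v)"
proof -
  obtain d :: "nat \<Rightarrow> nat"
    where d: "\<And>k v. norm v \<le> real (d k) * norm ((C + mat (of_nat k)) *v v)"
    using positive_stable_shift_expands[OF assms] by metis
  obtain c :: nat where c: "op_bound C (real c)"
    using op_bound_exists by blast
  (* From k0 on, (k + 1 + c + 2) * (k - c) - (k + 1)^2 = k - c * (c + 3) - 1 is nonnegative. *)
  define k0 where "k0 = c * (c + 3) + 1"
  define b where "b = c + 2 + (\<Sum>k<k0. (k + 1)\<^sup>2 * d k)"
  have "(real k + 1)\<^sup>2 * norm v \<le> (real k + 1 + real b) * norm ((C + mat (of_nat k)) *v v)"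
    for k v
  proof (cases "k < k0")
    case True
    then have "(k + 1)\<^sup>2 * d k \<le> (\<Sum>k<k0. (k + 1)\<^sup>2 * d k)"
      by (intro member_le_sum) auto
    then have "(k + 1)\<^sup>2 * d k \<le> b" by (simp add: b_def)
    then have "real ((k + 1)\<^sup>2 * d k) \<le> real b" by (rule of_nat_mono)
    then have b: "(real k + 1)\<^sup>2 * real (d k) \<le> real k + 1 + real b"
      by (simp add: add.commute)
    have "(real k + 1)\<^sup>2 * norm v
        \<le> (real k + 1)\<^sup>2 * (real (d k) * norm ((C + mat (of_nat k)) *v v))"
      by (intro mult_left_mono d) auto
    also have "\<dots> \<le> (real k + 1 + real b) * norm ((C + mat (of_nat k)) *v v)"
      unfolding mult.assoc[symmetric] by (intro mult_right_mono b) auto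
    finally show ?thesis .
  next
    case False
    then have "real k0 \<le> real k" by simp
    then have k: "real c * (real c + 3) + 1 \<le> real k"
      by (simp add: k0_def algebra_simps)
    moreover have "real c * 1 \<le> real c * (real c + 3)"
      by (intro mult_left_mono) auto
    ultimately have ck: "real c \<le> real k" by linarith
    have "real k * norm v = norm ((of_nat k :: complex) *s v)"
      by (simp add: norm_vector_scalar_mult)
    also have "\<dots> = norm ((C + mat (of_nat k)) *v v - C *v v)"
      by (simp add: matrix_vector_mult_add_rdistrib mat_mult_vector)
    also have "\<dots> \<le> norm ((C + mat (of_nat k)) *v v) + norm (C *v v)"
      by (rule norm_triangle_ineq4)
    also have "\<dots> \<le> norm ((C + mat (of_nat k)) *v v) + real c * norm v"
      using c by (simp add: op_bound_def)
    finally have expand: "(real k - real c) * norm v \<le> norm ((C + mat (of_nat k)) *v v)"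
      by (simp add: algebra_simps)
    have "(real k + 1)\<^sup>2 \<le> (real k + 1 + (real c + 2)) * (real k - real c)"
      using k by (simp add: power2_eq_square algebra_simps)
    also have "\<dots> \<le> (real k + 1 + real b) * (real k - real c)"
      using ck by (intro mult_right_mono) (auto simp: b_def sum_nonneg)
    finally have "(real k + 1)\<^sup>2 * norm v
        \<le> (real k + 1 + real b) * (real k - real c) * norm v"
      by (intro mult_right_mono) auto
    also have "\<dots> \<le> (real k + 1 + real b) * norm ((C + mat (of_nat k)) *v v)"
      unfolding mult.assoc by (intro mult_left_mono expand) auto
    finally show ?thesis .
  qed
  then show ?thesis by blast
qed

text \<open>
  The estimate is proved as a lower bound for the action of the Pochhammer product itself, which
  multiplies along the recursion without any handling of inverses.
\<close>

lemma matrix_inv_mat_pochhammer_bound: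
  fixes C :: "'r::finite cmatrix"
  assumes "positive_stable C"
  shows "\<exists>b. \<forall>m. op_bound (matrix_inv (mat_pochhammer C m)) ((real m + 1) ^ b / fact m)"
proof -
  obtain b :: nat where b: "\<And>k v. (real k + 1)\<^sup>2 * norm v
      \<le> (real k + 1 + real b) * norm ((C + mat (of_nat k)) *v v)"
    using positive_stable_shift_expands_uniformly[OF assms] by blast
  have lower: "fact m * norm v \<le> (real m + 1) ^ b * norm (mat_pochhammer C m *v v)" for m v
  proof (induction m arbitrary: v)
    case 0
    show ?case by simp
  next
    case (Suc m)
    define w where "w = (C + mat (of_nat m)) *v v"
    have "(real m + 1)\<^sup>2 * norm v * (real m + 1) ^ b
        \<le> (real m + 1 + real b) * norm w * (real m + 1) ^ b"
      unfolding w_def by (intro mult_right_mono b) auto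
    also have "\<dots> \<le> (real m + 1) * (real m + 2) ^ b * norm w"
      using mult_right_mono[OF shifted_factor_le_telescope[of m b], of "norm w"]
      by (simp add: mult_ac)
    finally have "(real m + 1) * ((real m + 1) * norm v * (real m + 1) ^ b)
        \<le> (real m + 1) * ((real m + 2) ^ b * norm w)"
      by (simp add: power2_eq_square mult_ac)
    then have step: "(real m + 1) * norm v * (real m + 1) ^ b \<le> (real m + 2) ^ b * norm w"
      by (rule mult_left_le_imp_le) simp
    have "(real m + 1) ^ b * (fact (Suc m) * norm v)
        = fact m * ((real m + 1) * norm v * (real m + 1) ^ b)"
      by (simp add: algebra_simps)
    also have "\<dots> \<le> fact m * ((real m + 2) ^ b * norm w)"
      by (intro mult_left_mono step) auto
    also have "\<dots> = (real m + 2) ^ b * (fact m * norm w)"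
      by (simp add: mult_ac)
    also have "\<dots> \<le> (real m + 2) ^ b * ((real m + 1) ^ b * norm (mat_pochhammer C m *v w))"
      by (intro mult_left_mono Suc) auto
    also have "\<dots> = (real m + 1) ^ b * ((real m + 2) ^ b * norm (mat_pochhammer C m *v w))"
      by (simp add: mult_ac)
    finally have "fact (Suc m) * norm v \<le> (real m + 2) ^ b * norm (mat_pochhammer C m *v w)"
      by (rule mult_left_le_imp_le) simp
    then show ?case
      by (simp add: w_def matrix_vector_mul_assoc add.commute)
  qed
  have "norm v \<le> (real m + 1) ^ b / fact m * norm (mat_pochhammer C m *v v)" for m v
    using lower[of m v] by (simp add: field_simps)
  then show ?thesis
    using op_bound_matrix_inv by blast
qed

section \<open>The convergent majorant\<close>

lemma prod_fact_le_fact_sum: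
  assumes "finite I"
  shows "(\<Prod>i\<in>I. fact (m i) :: real) \<le> fact (\<Sum>i\<in>I. m i)"
  using assms
proof (induction I rule: finite_induct)
  case empty
  show ?case by simp
next
  case (insert j I)
  have "(fact (m j) * fact (\<Sum>i\<in>I. m i) :: nat) \<le> fact (m j + (\<Sum>i\<in>I. m i))"
    by (intro dvd_imp_le fact_fact_dvd_fact) simp
  then have "real (fact (m j) * fact (\<Sum>i\<in>I. m i)) \<le> real (fact (m j + (\<Sum>i\<in>I. m i)))"
    by (rule of_nat_mono)
  then have binomial: "fact (m j) * fact (\<Sum>i\<in>I. m i) \<le> (fact (m j + (\<Sum>i\<in>I. m i)) :: real)"
    by simp
  have "fact (m j) * (\<Prod>i\<in>I. fact (m i) :: real) \<le> fact (m j) * fact (\<Sum>i\<in>I. m i)"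
    by (intro mult_left_mono insert.IH) auto
  from order_trans[OF this binomial] show ?case using insert.hyps by simp
qed

lemma Suc_sum_le_prod_Suc:
  assumes "finite I"
  shows "real (\<Sum>i\<in>I. m i) + 1 \<le> (\<Prod>i\<in>I. real (m i) + 1)"
proof -
  have "(\<Sum>i\<in>I. real (m i)) + 1 \<le> (\<Prod>i\<in>I. 1 + real (m i))"
    using assms
  proof (induction I rule: finite_induct)
    case (insert j I)
    have "1 \<le> (\<Prod>i\<in>I. 1 + real (m i))" by (intro prod_ge_1) auto
    then have "real (m j) * 1 \<le> real (m j) * (\<Prod>i\<in>I. 1 + real (m i))"
      by (intro mult_left_mono) auto
    with insert show ?case by (simp add: algebra_simps)
  qed simp
  then show ?thesis by (simp add: add.commute)
qed

lemma summable_polynomial_times_geometric: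
  fixes q :: real
  assumes "0 \<le> q" "q < 1"
  shows "summable (\<lambda>m. (real m + 1) ^ k * q ^ m)"
proof -
  (* Any ratio strictly between q and 1 absorbs the polynomial factor eventually. *)
  define r where "r = (q + 1) / 2"
  have r: "q < r" "r < 1" using assms by (auto simp: r_def)
  have "(\<lambda>m. (1 + inverse (real (Suc m))) ^ k * q) \<longlonglongrightarrow> 1 ^ k * q"
    by (intro tendsto_intros LIMSEQ_inverse_real_of_nat_add)
  then have "\<forall>\<^sub>F m in sequentially. (1 + inverse (real (Suc m))) ^ k * q < r"
    using r(1) by (intro order_tendstoD) auto
  then obtain N where N: "\<And>m. m \<ge> N \<Longrightarrow> (1 + inverse (real (Suc m))) ^ k * q < r"
    by (auto simp: eventually_sequentially)
  show ?thesis
  proof (rule summable_ratio_test[OF r(2)])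
    fix m assume m: "m \<ge> N"
    have "real (Suc m) + 1 = (1 + inverse (real (Suc m))) * (real m + 1)"
      by (simp add: field_simps)
    then have "(real (Suc m) + 1) ^ k * q ^ Suc m
        = (1 + inverse (real (Suc m))) ^ k * q * ((real m + 1) ^ k * q ^ m)"
      by (simp only: power_mult_distrib) simp
    also have "\<dots> \<le> r * ((real m + 1) ^ k * q ^ m)"
      using N[OF m] assms by (intro mult_right_mono) auto
    finally show "norm ((real (Suc m) + 1) ^ k * q ^ Suc m) \<le> r * norm ((real m + 1) ^ k * q ^ m)"
      using assms by simp
  qed
qed

theorem theorem3p6:
  fixes n :: nat
    and A B :: "nat \<Rightarrow> complex ^ 'r::finite ^ 'r"
    and C :: "complex ^ 'r ^ 'r"
    and x :: "nat \<Rightarrow> complex"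
  assumes "n \<ge> 1"
    and "\<And>i. i \<in> {1..n} \<Longrightarrow> positive_stable (A i)"
    and "\<And>i. i \<in> {1..n} \<Longrightarrow> positive_stable (B i)"
    and "positive_stable C"
    and "\<And>i. i \<in> {1..n} \<Longrightarrow> spec_max (A i) + spec_max (B i) < 2"
    and "spec_min C > 1"
    and "\<And>i. i \<in> {1..n} \<Longrightarrow> norm (x i) < 1"
  shows "F_B_converges_absolutely n A B C x"
proof -
  obtain a where a: "\<And>i m. op_bound (mat_pochhammer (A i) m) (fact m * (real m + 1) ^ a i)"
    using choice[of "\<lambda>i a. \<forall>m. op_bound (mat_pochhammer (A i) m) (fact m * (real m + 1) ^ a)"]
      mat_pochhammer_upper_bound by blast
  obtain b where b: "\<And>i m. op_bound (mat_pochhammer (B i) m) (fact m * (real m + 1) ^ b i)"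
    using choice[of "\<lambda>i a. \<forall>m. op_bound (mat_pochhammer (B i) m) (fact m * (real m + 1) ^ a)"]
      mat_pochhammer_upper_bound by blast
  obtain c where c:
    "\<And>m. op_bound (matrix_inv (mat_pochhammer C m)) ((real m + 1) ^ c / fact m)"
    using matrix_inv_mat_pochhammer_bound[OF assms(4)] by blast
  define K where "K = (real CARD('r))\<^sup>2"
  define g where "g = (\<lambda>i (k::nat). (real k + 1) ^ (a i + b i + c) * norm (x i) ^ k)"

  have "Infinite_Sum.abs_summable_on (\<lambda>m. \<Prod>i\<in>{1..n}. g i (m i)) (PiE {1..n} (\<lambda>_. UNIV))"
    unfolding abs_summable_equivalent
  proof (rule Infinite_Set_Sum.abs_summable_on_prod_PiE)
    fix i assume "i \<in> {1..n}"
    then have "summable (g i)"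
      unfolding g_def by (intro summable_polynomial_times_geometric assms(7)) auto
    moreover have "norm (g i k) = g i k" for k by (simp add: g_def)
    ultimately show "Infinite_Set_Sum.abs_summable_on (g i) UNIV"
      by (simp add: Infinite_Set_Sum.abs_summable_on_nat_iff')
  qed auto
  then have majorant: "(\<lambda>m. K * (\<Prod>i\<in>{1..n}. g i (m i))) summable_on multi_indices n"
    unfolding multi_indices_def
    by (rule summable_on_cmult_right[OF abs_summable_summable])

  have "norm (F_B_term n A B C x m) \<le> K * (\<Prod>i\<in>{1..n}. g i (m i))" for m
  proof -
    define N where "N = (\<Sum>i=1..n. m i)"
    define G where "G = (\<Prod>i=1..n. fact (m i) :: real)"
    define P where "P = (\<lambda>e::nat \<Rightarrow> nat. \<Prod>i=1..n. (real (m i) + 1) ^ e i)"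
    have G: "G > 0" "G \<le> fact N"
      using prod_fact_le_fact_sum by (auto simp: G_def N_def intro: prod_pos)
    have P: "P e \<ge> 0" for e by (auto simp: P_def intro: prod_nonneg)
    have upper: "op_bound (mat_prod (\<lambda>i. mat_pochhammer (X i) (m i)) n) (G * P e)"
      if "\<And>i m. op_bound (mat_pochhammer (X i) m) (fact m * (real m + 1) ^ e i)"
      for X :: "nat \<Rightarrow> complex ^ 'r ^ 'r" and e
      unfolding G_def P_def prod.distrib[symmetric] by (intro op_bound_mat_prod that) auto
    have "real N + 1 \<le> (\<Prod>i=1..n. real (m i) + 1)"
      unfolding N_def by (rule Suc_sum_le_prod_Suc) simp
    then have "(real N + 1) ^ c \<le> (\<Prod>i=1..n. real (m i) + 1) ^ c"
      by (rule power_mono) simp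
    then have N: "(real N + 1) ^ c \<le> P (\<lambda>_. c)"
      by (simp add: P_def prod_power_distrib)
    have "op_bound (mat_prod (\<lambda>i. mat_pochhammer (A i) (m i)) n **
        mat_prod (\<lambda>i. mat_pochhammer (B i) (m i)) n ** matrix_inv (mat_pochhammer C N))
        (G * P a * (G * P b) * ((real N + 1) ^ c / fact N))"
      using G P by (intro op_bound_mult upper a b c) auto
    then have "norm (F_B_term n A B C x m) \<le> cmod (\<Prod>i=1..n. x i ^ m i / fact (m i)) *
        (K * (G * P a * (G * P b) * ((real N + 1) ^ c / fact N)))"
      unfolding F_B_term_def norm_mat_scale N_def K_def
      by (intro mult_left_mono norm_le_of_op_bound) auto
    (* One factor G cancels the denominators m_i!, the other is absorbed by N!. *)
    also have "cmod (\<Prod>i=1..n. x i ^ m i / fact (m i)) = (\<Prod>i=1..n. norm (x i) ^ m i) / G"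
      by (simp add: G_def prod_norm[symmetric] norm_divide norm_power prod_dividef)
    also have "(\<Prod>i=1..n. norm (x i) ^ m i) / G *
          (K * (G * P a * (G * P b) * ((real N + 1) ^ c / fact N)))
        = K * (\<Prod>i=1..n. norm (x i) ^ m i) * P a * P b * ((G / fact N) * (real N + 1) ^ c)"
      using G by (simp add: field_simps)
    also have "\<dots> \<le> K * (\<Prod>i=1..n. norm (x i) ^ m i) * P a * P b * (1 * P (\<lambda>_. c))"
      using G P N by (intro mult_left_mono mult_mono)
        (auto simp: K_def intro!: mult_nonneg_nonneg prod_nonneg)
    also have "\<dots> = K * (\<Prod>i\<in>{1..n}. g i (m i))"
      by (simp add: P_def g_def power_add prod.distrib mult_ac)
    finally show ?thesis .
  qed
  then have "(\<lambda>m. norm (F_B_term n A B C x m)) summable_on multi_indices n"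
    by (intro summable_on_comparison_test[OF majorant]) auto
  then show ?thesis by (simp add: F_B_converges_absolutely_def)
qed

end
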